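(* Let $(A,\rhd,\lhd,\delta_{\rhd,r},\delta_{\lhd,r})$ be a factorizable bi-dialgebra with $\widetilde{\alpha}=\widetilde{r}-\widetilde{r}^t$, and let $\lambda\in\mathbb F$, $\lambda\neq 0$. Then $(A,\rhd,\lhd,\mathfrak{B},P)$ is a skew-symmetric Rota-Baxter Frobenius dialgebra of weight $\lambda$, where the bilinear form $\mathfrak{B}$ and the linear map $P:A\to A$ are defined by $$\mathfrak{B}(x,y)=-\lambda\langle\widetilde{\alpha}^{-1}(x),y\rangle,\quad x,y\in A,\qquad P=-\lambda\,\widetilde{r}\circ\widetilde{\alpha}^{-1}.$$
   Context: All vector spaces and algebras are finite-dimensional over a field $\mathbb F$ of characteristic $0$; algebras are not assumed unital. Notation: $x\star y=x\rhd y-x\lhd y$; $L_\diamond(x)y=x\diamond y=R_\diamond(y)x$; $\tau(x\otimes y)=y\otimes x$. For $r\in A\otimes A$: $\langle\widetilde{r}(u^* ),v^*\rangle=\langle r,u^*\otimes v^*\rangle=\langle\widetilde{r}^t(v^* ),u^*\rangle$ defines $\widetilde r,\widetilde r^t:A^*\to A$. **Dialgebra.** $(A,\rhd,\lhd)$ where $\rhd,\lhd$ are associative bilinear products with $(x\lhd y)\lhd z=x\lhd(y\rhd z)$, $(x\rhd y)\lhd z=x\rhd(y\lhd z)$, $(x\lhd y)\rhd z=x\rhd(y\rhd z)$. A bilinear form $\mathfrak{B}$ on it is invariant if $\mathfrak{B}(x\rhd y,z)=\mathfrak{B}(x,y\rhd z-y\lhd z)$ and $\mathfrak{B}(x\lhd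 y,z)=\mathfrak{B}(x,y\rhd z)$. A skew-symmetric Frobenius dialgebra is a dialgebra with a nondegenerate skew-symmetric invariant bilinear form. **Rota-Baxter.** A Rota-Baxter operator of weight $\lambda\in\mathbb F$ on a dialgebra is a linear map $P:A\to A$ with $P(x)\diamond P(y)=P(P(x)\diamond y+x\diamond P(y)+\lambda\,x\diamond y)$ for $\diamond\in\{\rhd,\lhd\}$ and all $x,y$. A skew-symmetric Rota-Baxter Frobenius dialgebra of weight $\lambda$ is $(A,\rhd,\lhd,\mathfrak{B},P)$ with $(A,\rhd,\lhd,\mathfrak{B})$ a skew-symmetric Frobenius dialgebra, $P$ a Rota-Baxter operator of weight $\lambda$ on $(A,\rhd,\lhd)$, and $\mathfrak{B}(P(x),y)+\mathfrak{B}(x,P(y))+\lambda\mathfrak{B}(x,y)=0$ for all $x,y$. **Factorizable bi-dialgebra.** For $r=\sum_i a_i\otimes b_i\in A\otimes A$ put $E(x)=R_{\star}(x)\otimes\mathrm{id}+\mathrm{id}\otimes L_{\lhd}(x)$, $F(x)=R_{\rhd}(x)\otimes\mathrm{id}-\mathrm{id}\otimes L_{\star}(x)$, $\delta_{\rhd,r}(x)=E(x)r$, $\delta_{\lhd,r}(x)=F(x)r$. $r$ solves the diassociative Yang-Baxter equation (DAYBE) if $\sum_{i,j}\big(a_i\otimes a_j\otimes b_i\rhd b_j-a_j\otimes a_i\lhd b_j\otimes b_i-a_i\star a_j\otimes b_i\otimes b_j\big)=0$. An element $s\in A\otimes A$ is invariant if $E(x)s=F(x)s=0$ for all $x$. The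 skew-symmetric part of $r$ is $\alpha=r-\tau(r)$. If $r$ solves the DAYBE and $\alpha$ is invariant, then $(A,\rhd,\lhd,\delta_{\rhd,r},\delta_{\lhd,r})$ is a bi-dialgebra (a dialgebra and a co-dialgebra satisfying certain compatibility conditions, which hold automatically for such $r$), called quasi-triangular; it is factorizable if moreover $\widetilde{\alpha}=\widetilde r-\widetilde r^t:A^*\to A$ is a linear isomorphism. Thus the hypothesis is: $r$ solves the DAYBE, $\alpha$ is invariant and $\widetilde\alpha$ is bijective. *)

theory Defs
  imports Complex_Main "HOL-Library.Poly_Mapping"
begin

section \<open>Bilinear maps and the dual space\<close>

text \<open>
  A vector space over the field \<open>'f\<close> is a type \<open>'a\<close> with a scalar multiplication
  \<open>scale\<close> satisfying \<^locale>\<open>vector_space\<close>; the field itself is a vector space via \<open>(*)\<close>.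
\<close>

definition bilinear_map ::
    "('f::field \<Rightarrow> 'a::ab_group_add \<Rightarrow> 'a) \<Rightarrow> ('f \<Rightarrow> 'c::ab_group_add \<Rightarrow> 'c) \<Rightarrow> ('a \<Rightarrow> 'a \<Rightarrow> 'c) \<Rightarrow> bool"
  where "bilinear_map sA sC f \<longleftrightarrow>
    (\<forall>x. Vector_Spaces.linear sA sC (f x)) \<and> (\<forall>y. Vector_Spaces.linear sA sC (\<lambda>x. f x y))"

definition dual_space :: "('f::field \<Rightarrow> 'a::ab_group_add \<Rightarrow> 'a) \<Rightarrow> ('a \<Rightarrow> 'f) set"
  where "dual_space scale = {u. Vector_Spaces.linear scale (*) u}"

locale finite_dim_space = vector_space scale
  for scale :: "'f::field_char_0 \<Rightarrow> 'a::ab_group_add \<Rightarrow> 'a" +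
  assumes finite_dim: "\<exists>B. finite B \<and> span B = UNIV"


section \<open>Dialgebras, Frobenius forms and Rota-Baxter operators\<close>

locale dialgebra = finite_dim_space scale
  for scale :: "'f::field_char_0 \<Rightarrow> 'a::ab_group_add \<Rightarrow> 'a" +
  fixes dr :: "'a \<Rightarrow> 'a \<Rightarrow> 'a"  (infixl \<open>\<rhd>\<close> 70)
    and dl :: "'a \<Rightarrow> 'a \<Rightarrow> 'a"  (infixl \<open>\<lhd>\<close> 70)
  assumes bilinear_dr: "bilinear_map scale scale (\<rhd>)"
    and bilinear_dl: "bilinear_map scale scale (\<lhd>)"
    and assoc_dr: "(x \<rhd> y) \<rhd> z = x \<rhd> (y \<rhd> z)"
    and assoc_dl: "(x \<lhd> y) \<lhd> z = x \<lhd> (y \<lhd> z)"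
    and dl_dl_dr: "(x \<lhd> y) \<lhd> z = x \<lhd> (y \<rhd> z)"
    and dr_dl: "(x \<rhd> y) \<lhd> z = x \<rhd> (y \<lhd> z)"
    and dl_dr_dr: "(x \<lhd> y) \<rhd> z = x \<rhd> (y \<rhd> z)"

locale skew_symmetric_Frobenius_dialgebra = dialgebra scale dr dl
  for scale :: "'f::field_char_0 \<Rightarrow> 'a::ab_group_add \<Rightarrow> 'a"
    and dr :: "'a \<Rightarrow> 'a \<Rightarrow> 'a"  (infixl \<open>\<rhd>\<close> 70)
    and dl :: "'a \<Rightarrow> 'a \<Rightarrow> 'a"  (infixl \<open>\<lhd>\<close> 70) +
  fixes B :: "'a \<Rightarrow> 'a \<Rightarrow> 'f"
  assumes bilinear_form: "bilinear_map scale (*) B"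
    and nondegenerate_left: "(\<And>y. B x y = 0) \<Longrightarrow> x = 0"
    and nondegenerate_right: "(\<And>x. B x y = 0) \<Longrightarrow> y = 0"
    and skew_symmetric: "B x y = - B y x"
    and invariant_dr: "B (x \<rhd> y) z = B x (y \<rhd> z - y \<lhd> z)"
    and invariant_dl: "B (x \<lhd> y) z = B x (y \<rhd> z)"

definition Rota_Baxter_operator ::
    "('f::field \<Rightarrow> 'a::ab_group_add \<Rightarrow> 'a) \<Rightarrow> ('a \<Rightarrow> 'a \<Rightarrow> 'a) \<Rightarrow> ('a \<Rightarrow> 'a \<Rightarrow> 'a) \<Rightarrow> 'f \<Rightarrow> ('a \<Rightarrow> 'a) \<Rightarrow> bool"
  where "Rota_Baxter_operator scale dr dl l P \<longleftrightarrow>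
    Vector_Spaces.linear scale scale P \<and>
    (\<forall>m \<in> {dr, dl}. \<forall>x y. m (P x) (P y) = P (m (P x) y + m x (P y) + scale l (m x y)))"

locale skew_symmetric_Rota_Baxter_Frobenius_dialgebra =
  skew_symmetric_Frobenius_dialgebra scale dr dl B
  for scale :: "'f::field_char_0 \<Rightarrow> 'a::ab_group_add \<Rightarrow> 'a"
    and dr :: "'a \<Rightarrow> 'a \<Rightarrow> 'a"  (infixl \<open>\<rhd>\<close> 70)
    and dl :: "'a \<Rightarrow> 'a \<Rightarrow> 'a"  (infixl \<open>\<lhd>\<close> 70)
    and B :: "'a \<Rightarrow> 'a \<Rightarrow> 'f" +
  fixes P :: "'a \<Rightarrow> 'a"
    and l :: 'f
  assumes Rota_Baxter: "Rota_Baxter_operator scale (\<rhd>) (\<lhd>) l P"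
    and compatible: "B (P x) y + B x (P y) + l * B x y = 0"


section \<open>Tensor powers\<close>

text \<open>
  The tensor product over the field is the free abelian group on pairs (triples), modulo the
  subgroup generated by additivity in each slot and by moving scalars from one slot to the next.
  An element of \<open>A \<otimes> A\<close> is given by a representative \<open>r :: ('a \<times> 'a) \<Rightarrow>\<^sub>0 int\<close>, where
  \<open>frag_of (x, y)\<close> stands for \<open>x \<otimes> y\<close>; every tensor has one, as \<open>c (x \<otimes> y) = (c x) \<otimes> y\<close>.
  Representatives \<open>p\<close>, \<open>q\<close> denote the same tensor iff \<open>p - q\<close> lies in the null subgroup.
  All constructions on representatives below are compatible with this equality
  (see the lemmas at the end).
\<close>

inductive_set tensor2_null :: "('f::field \<Rightarrow> 'a::ab_group_add \<Rightarrow> 'a) \<Rightarrow> (('a \<times> 'a) \<Rightarrow>\<^sub>0 int) set"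
  for scale :: "'f::field \<Rightarrow> 'a::ab_group_add \<Rightarrow> 'a"
  where
    zero: "0 \<in> tensor2_null scale"
  | diff: "p \<in> tensor2_null scale \<Longrightarrow> q \<in> tensor2_null scale \<Longrightarrow> p - q \<in> tensor2_null scale"
  | add1: "frag_of (x + x', y) - frag_of (x, y) - frag_of (x', y) \<in> tensor2_null scale"
  | add2: "frag_of (x, y + y') - frag_of (x, y) - frag_of (x, y') \<in> tensor2_null scale"
  | scale12: "frag_of (scale c x, y) - frag_of (x, scale c y) \<in> tensor2_null scale"

inductive_set tensor3_null :: "('f::field \<Rightarrow> 'a::ab_group_add \<Rightarrow> 'a) \<Rightarrow> (('a \<times> 'a \<times> 'a) \<Rightarrow>\<^sub>0 int) set"
  for scale :: "'f::field \<Rightarrow> 'a::ab_group_add \<Rightarrow> 'a"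
  where
    zero: "0 \<in> tensor3_null scale"
  | diff: "p \<in> tensor3_null scale \<Longrightarrow> q \<in> tensor3_null scale \<Longrightarrow> p - q \<in> tensor3_null scale"
  | add1: "frag_of (x + x', y, z) - frag_of (x, y, z) - frag_of (x', y, z) \<in> tensor3_null scale"
  | add2: "frag_of (x, y + y', z) - frag_of (x, y, z) - frag_of (x, y', z) \<in> tensor3_null scale"
  | add3: "frag_of (x, y, z + z') - frag_of (x, y, z) - frag_of (x, y, z') \<in> tensor3_null scale"
  | scale12: "frag_of (scale c x, y, z) - frag_of (x, scale c y, z) \<in> tensor3_null scale"
  | scale23: "frag_of (x, scale c y, z) - frag_of (x, y, scale c z) \<in> tensor3_null scale"

definition tensor_map :: "('a \<Rightarrow> 'a) \<Rightarrow> ('a \<Rightarrow> 'a) \<Rightarrow> (('a \<times> 'a) \<Rightarrow>\<^sub>0 int) \<Rightarrow> (('a \<times> 'a) \<Rightarrow>\<^sub>0 int)"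
  where "tensor_map f g = frag_extend (\<lambda>(x, y). frag_of (f x, g y))"

definition tensor_flip :: "(('a \<times> 'a) \<Rightarrow>\<^sub>0 int) \<Rightarrow> (('a \<times> 'a) \<Rightarrow>\<^sub>0 int)"
  where "tensor_flip = frag_extend (\<lambda>(x, y). frag_of (y, x))"

text \<open>The pairing \<open>\<langle>r, u \<otimes> v\<rangle>\<close> for \<open>u\<close>, \<open>v\<close> in the dual space.\<close>

definition tensor_pairing :: "(('a \<times> 'a) \<Rightarrow>\<^sub>0 int) \<Rightarrow> ('a \<Rightarrow> 'f::field) \<Rightarrow> ('a \<Rightarrow> 'f) \<Rightarrow> 'f"
  where "tensor_pairing r u v =
    (\<Sum>(a, b) \<in> Poly_Mapping.keys r. of_int (Poly_Mapping.lookup r (a, b)) * (u a * v b))"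

text \<open>
  For \<open>r = \<Sum>\<^sub>i a\<^sub>i \<otimes> b\<^sub>i\<close> the two induced maps from the dual space to \<open>A\<close> send \<open>u\<close> to
  \<open>\<Sum>\<^sub>i u(a\<^sub>i) b\<^sub>i\<close> and \<open>\<Sum>\<^sub>i u(b\<^sub>i) a\<^sub>i\<close>. That these are the maps determined by the pairing is
  proved below.
\<close>

definition tensor_hom ::
    "('f::field \<Rightarrow> 'a::ab_group_add \<Rightarrow> 'a) \<Rightarrow> (('a \<times> 'a) \<Rightarrow>\<^sub>0 int) \<Rightarrow> ('a \<Rightarrow> 'f) \<Rightarrow> 'a"
  where "tensor_hom scale r u =
    (\<Sum>(a, b) \<in> Poly_Mapping.keys r. scale (of_int (Poly_Mapping.lookup r (a, b)) * u a) b)"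

definition tensor_hom_t ::
    "('f::field \<Rightarrow> 'a::ab_group_add \<Rightarrow> 'a) \<Rightarrow> (('a \<times> 'a) \<Rightarrow>\<^sub>0 int) \<Rightarrow> ('a \<Rightarrow> 'f) \<Rightarrow> 'a"
  where "tensor_hom_t scale r v =
    (\<Sum>(a, b) \<in> Poly_Mapping.keys r. scale (of_int (Poly_Mapping.lookup r (a, b)) * v b) a)"


section \<open>Factorizable bi-dialgebras\<close>

definition star :: "('a \<Rightarrow> 'a \<Rightarrow> 'a) \<Rightarrow> ('a \<Rightarrow> 'a \<Rightarrow> 'a) \<Rightarrow> 'a \<Rightarrow> 'a \<Rightarrow> 'a::ab_group_add"
  where "star dr dl x y = dr x y - dl x y"

text \<open>
  The operators \<open>E(x) = R\<^sub>\<star>(x) \<otimes> id + id \<otimes> L\<^sub>\<lhd>(x)\<close> and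
  \<open>F(x) = R\<^sub>\<rhd>(x) \<otimes> id - id \<otimes> L\<^sub>\<star>(x)\<close>. The coproducts defined by \<open>r\<close> are
  \<open>x \<mapsto> E(x) r\<close> and \<open>x \<mapsto> F(x) r\<close>.
\<close>

definition E_op :: "('a \<Rightarrow> 'a \<Rightarrow> 'a) \<Rightarrow> ('a \<Rightarrow> 'a \<Rightarrow> 'a) \<Rightarrow> 'a::ab_group_add
    \<Rightarrow> (('a \<times> 'a) \<Rightarrow>\<^sub>0 int) \<Rightarrow> (('a \<times> 'a) \<Rightarrow>\<^sub>0 int)"
  where "E_op dr dl x r = tensor_map (\<lambda>y. star dr dl y x) id r + tensor_map id (\<lambda>y. dl x y) r"

definition F_op :: "('a \<Rightarrow> 'a \<Rightarrow> 'a) \<Rightarrow> ('a \<Rightarrow> 'a \<Rightarrow> 'a) \<Rightarrow> 'a::ab_group_add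
    \<Rightarrow> (('a \<times> 'a) \<Rightarrow>\<^sub>0 int) \<Rightarrow> (('a \<times> 'a) \<Rightarrow>\<^sub>0 int)"
  where "F_op dr dl x r = tensor_map (\<lambda>y. dr y x) id r - tensor_map id (\<lambda>y. star dr dl x y) r"

definition invariant_tensor ::
    "('f::field \<Rightarrow> 'a::ab_group_add \<Rightarrow> 'a) \<Rightarrow> ('a \<Rightarrow> 'a \<Rightarrow> 'a) \<Rightarrow> ('a \<Rightarrow> 'a \<Rightarrow> 'a)
      \<Rightarrow> (('a \<times> 'a) \<Rightarrow>\<^sub>0 int) \<Rightarrow> bool"
  where "invariant_tensor scale dr dl s \<longleftrightarrow>
    (\<forall>x. E_op dr dl x s \<in> tensor2_null scale \<and> F_op dr dl x s \<in> tensor2_null scale)"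

text \<open>
  The left-hand side of the diassociative Yang-Baxter equation, as a biadditive function of two
  tensors \<open>\<Sum>\<^sub>i a\<^sub>i \<otimes> b\<^sub>i\<close> and \<open>\<Sum>\<^sub>j a\<^sub>j \<otimes> b\<^sub>j\<close>, written \<open>(a, b)\<close> and \<open>(a', b')\<close>.
\<close>

definition DAYBE_form :: "('a \<Rightarrow> 'a \<Rightarrow> 'a) \<Rightarrow> ('a \<Rightarrow> 'a \<Rightarrow> 'a)
    \<Rightarrow> (('a::ab_group_add \<times> 'a) \<Rightarrow>\<^sub>0 int) \<Rightarrow> (('a \<times> 'a) \<Rightarrow>\<^sub>0 int) \<Rightarrow> (('a \<times> 'a \<times> 'a) \<Rightarrow>\<^sub>0 int)"
  where "DAYBE_form dr dl r s =
    frag_extend (\<lambda>(a, b). frag_extend (\<lambda>(a', b').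
        frag_of (a, a', dr b b') - frag_of (a', dl a b', b) - frag_of (star dr dl a a', b, b')) s) r"

definition solves_DAYBE ::
    "('f::field \<Rightarrow> 'a::ab_group_add \<Rightarrow> 'a) \<Rightarrow> ('a \<Rightarrow> 'a \<Rightarrow> 'a) \<Rightarrow> ('a \<Rightarrow> 'a \<Rightarrow> 'a)
      \<Rightarrow> (('a \<times> 'a) \<Rightarrow>\<^sub>0 int) \<Rightarrow> bool"
  where "solves_DAYBE scale dr dl r \<longleftrightarrow> DAYBE_form dr dl r r \<in> tensor3_null scale"

definition alpha_hom ::
    "('f::field \<Rightarrow> 'a::ab_group_add \<Rightarrow> 'a) \<Rightarrow> (('a \<times> 'a) \<Rightarrow>\<^sub>0 int) \<Rightarrow> ('a \<Rightarrow> 'f) \<Rightarrow> 'a"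
  where "alpha_hom scale r u = tensor_hom scale r u - tensor_hom_t scale r u"

text \<open>
  The map \<open>alpha_hom scale r\<close> is linear by construction, so it is a linear isomorphism iff it is
  bijective on the dual space.
\<close>

locale factorizable_bidialgebra = dialgebra scale dr dl
  for scale :: "'f::field_char_0 \<Rightarrow> 'a::ab_group_add \<Rightarrow> 'a"
    and dr :: "'a \<Rightarrow> 'a \<Rightarrow> 'a"  (infixl \<open>\<rhd>\<close> 70)
    and dl :: "'a \<Rightarrow> 'a \<Rightarrow> 'a"  (infixl \<open>\<lhd>\<close> 70) +
  fixes r :: "('a \<times> 'a) \<Rightarrow>\<^sub>0 int"
  assumes DAYBE: "solves_DAYBE scale (\<rhd>) (\<lhd>) r"
    and invariant_skew_part: "invariant_tensor scale (\<rhd>) (\<lhd>) (r - tensor_flip r)"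
    and factorizable: "bij_betw (alpha_hom scale r) (dual_space scale) UNIV"

definition alpha_inv ::
    "('f::field \<Rightarrow> 'a::ab_group_add \<Rightarrow> 'a) \<Rightarrow> (('a \<times> 'a) \<Rightarrow>\<^sub>0 int) \<Rightarrow> 'a \<Rightarrow> ('a \<Rightarrow> 'f)"
  where "alpha_inv scale r = inv_into (dual_space scale) (alpha_hom scale r)"

section \<open>Independence of representatives\<close>

lemma tensor2_null_uminus: "p \<in> tensor2_null scale \<Longrightarrow> - p \<in> tensor2_null scale"
  using tensor2_null.diff[OF tensor2_null.zero] by force

lemma tensor2_null_plus:
  "p \<in> tensor2_null scale \<Longrightarrow> q \<in> tensor2_null scale \<Longrightarrow> p + q \<in> tensor2_null scale"
  using tensor2_null.diff[OF _ tensor2_null_uminus] by force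

lemma tensor3_null_uminus: "p \<in> tensor3_null scale \<Longrightarrow> - p \<in> tensor3_null scale"
  using tensor3_null.diff[OF tensor3_null.zero] by force

lemma tensor3_null_plus:
  "p \<in> tensor3_null scale \<Longrightarrow> q \<in> tensor3_null scale \<Longrightarrow> p + q \<in> tensor3_null scale"
  using tensor3_null.diff[OF _ tensor3_null_uminus] by force

lemma sum_keys_plus:
  fixes g :: "'k \<Rightarrow> int \<Rightarrow> 'c::comm_monoid_add" and p q :: "'k \<Rightarrow>\<^sub>0 int"
  assumes zero: "\<And>k. g k 0 = 0" and plus: "\<And>k m n. g k (m + n) = g k m + g k n"
  shows "(\<Sum>k \<in> Poly_Mapping.keys (p + q). g k (Poly_Mapping.lookup (p + q) k)) =
    (\<Sum>k \<in> Poly_Mapping.keys p. g k (Poly_Mapping.lookup p k)) +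
    (\<Sum>k \<in> Poly_Mapping.keys q. g k (Poly_Mapping.lookup q k))"
proof -
  let ?S = "Poly_Mapping.keys p \<union> Poly_Mapping.keys q"
  have *: "(\<Sum>k \<in> Poly_Mapping.keys t. g k (Poly_Mapping.lookup t k)) =
      (\<Sum>k \<in> ?S. g k (Poly_Mapping.lookup t k))" if "Poly_Mapping.keys t \<subseteq> ?S" for t
    by (rule sum.mono_neutral_left) (use that zero in \<open>auto simp: in_keys_iff\<close>)
  show ?thesis
    by (subst (1 2 3) *) (auto simp: lookup_add plus sum.distrib dest: set_mp[OF Poly_Mapping.keys_add])
qed

lemma tensor_pairing_plus: "tensor_pairing (p + q) u v = tensor_pairing p u v + tensor_pairing q u v"
  using sum_keys_plus[of "\<lambda>k n. of_int n * (u (fst k) * v (snd k))" p q]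
  by (simp add: tensor_pairing_def case_prod_beta algebra_simps)

lemma tensor_pairing_frag_of [simp]: "tensor_pairing (frag_of (a, b)) u v = u a * v b"
  by (simp add: tensor_pairing_def)

lemma tensor_pairing_diff: "tensor_pairing (p - q) u v = tensor_pairing p u v - tensor_pairing q u v"
  using tensor_pairing_plus[of "p - q" q u v] by (simp add: algebra_simps)

lemma dual_space_simps:
  assumes "u \<in> dual_space scale"
  shows "u (x + y) = u x + u y" "u (x - y) = u x - u y" "u (- x) = - u x" "u 0 = 0"
    "u (scale c x) = c * u x" "u (sum f S) = (\<Sum>s\<in>S. u (f s))"
proof -
  interpret Vector_Spaces.linear scale "(*)" u
    using assms by (simp add: dual_space_def)
  show "u (x + y) = u x + u y" "u (x - y) = u x - u y" "u (- x) = - u x" "u 0 = 0"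
    "u (scale c x) = c * u x" "u (sum f S) = (\<Sum>s\<in>S. u (f s))"
    by (simp_all add: add diff neg zero scale sum)
qed

lemma tensor_pairing_null:
  assumes "p \<in> tensor2_null scale" "u \<in> dual_space scale" "v \<in> dual_space scale"
  shows "tensor_pairing p u v = 0"
  using assms(1)
proof induction
  case zero
  show ?case by (simp add: tensor_pairing_def)
qed (simp_all add: tensor_pairing_diff tensor_pairing_plus dual_space_simps[OF assms(2)] dual_space_simps[OF assms(3)]
      algebra_simps)

lemma dual_space_separates:
  assumes "vector_space scale" "\<And>v. v \<in> dual_space scale \<Longrightarrow> v x = v y"
  shows "x = y"
proof (rule ccontr)
  assume "x \<noteq> y"
  interpret vector_space_pair scale "(*)"
    by (intro vector_space_pair.intro assms(1)) (unfold_locales; simp add: algebra_simps)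
  have "vs1.independent {x - y}"
    using \<open>x \<noteq> y\<close> by (simp add: vs1.dependent_single)
  then obtain v where v: "Vector_Spaces.linear scale (*) v" "v (x - y) = 1"
    using linear_independent_extend[of "{x - y}" "\<lambda>_. 1"] by auto
  then have "v \<in> dual_space scale"
    by (simp add: dual_space_def)
  with assms(2)[of v] v(2) show False
    by (simp add: dual_space_simps)
qed

lemma tensor_hom_dual:
  "v \<in> dual_space scale \<Longrightarrow> v (tensor_hom scale r u) = tensor_pairing r u v"
  by (auto simp: tensor_hom_def tensor_pairing_def dual_space_simps intro!: sum.cong)

lemma tensor_hom_t_dual:
  "u \<in> dual_space scale \<Longrightarrow> u (tensor_hom_t scale r v) = tensor_pairing r u v"
  by (auto simp: tensor_hom_t_def tensor_pairing_def dual_space_simps intro!: sum.cong)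

lemma tensor_hom_unique:
  assumes "vector_space scale"
  shows "x = tensor_hom scale r u \<longleftrightarrow> (\<forall>v \<in> dual_space scale. v x = tensor_pairing r u v)"
  using dual_space_separates[OF assms] by (metis tensor_hom_dual)

lemma tensor_hom_t_unique:
  assumes "vector_space scale"
  shows "x = tensor_hom_t scale r v \<longleftrightarrow> (\<forall>u \<in> dual_space scale. u x = tensor_pairing r u v)"
  using dual_space_separates[OF assms] by (metis tensor_hom_t_dual)

lemma tensor_flip_pairing: "tensor_pairing (tensor_flip r) u v = tensor_pairing r v u"
proof -
  have "Poly_Mapping.keys r \<subseteq> UNIV" by simp
  then show ?thesis
  proof (induction r rule: frag_induction)
    case zero
    show ?case by (simp add: tensor_flip_def tensor_pairing_def)
  next
    case (one k)
    show ?case by (cases k) (simp add: tensor_flip_def)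
  next
    case (diff p q)
    then show ?case by (simp add: tensor_flip_def frag_extend_diff tensor_pairing_diff)
  qed
qed

lemma alpha_hom_eq:
  assumes "vector_space scale" "u \<in> dual_space scale"
  shows "alpha_hom scale r u = tensor_hom scale (r - tensor_flip r) u"
  unfolding tensor_hom_unique[OF assms(1)] alpha_hom_def
  by (simp add: dual_space_simps tensor_hom_dual tensor_hom_t_dual tensor_pairing_diff
      tensor_flip_pairing)

lemma tensor_map_null:
  assumes f: "Vector_Spaces.linear scale scale f" and g: "Vector_Spaces.linear scale scale g"
    and p: "p \<in> tensor2_null scale"
  shows "tensor_map f g p \<in> tensor2_null scale"
proof -
  interpret f: Vector_Spaces.linear scale scale f by (rule f)
  interpret g: Vector_Spaces.linear scale scale g by (rule g)
  from p show ?thesis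
    by induction (simp_all add: tensor_map_def frag_extend_diff f.add g.add f.scale g.scale
        tensor2_null.intros)
qed

lemma tensor_flip_null:
  assumes "p \<in> tensor2_null scale"
  shows "tensor_flip p \<in> tensor2_null scale"
  using assms
proof induction
  case (scale12 c x y)
  have "- (frag_of (scale c y, x) - frag_of (y, scale c x)) \<in> tensor2_null scale"
    by (intro tensor2_null_uminus tensor2_null.scale12)
  then show ?case by (simp add: tensor_flip_def frag_extend_diff)
qed (simp_all add: tensor_flip_def frag_extend_diff tensor2_null.intros)

lemma frag_extend_fun_diff:
  "frag_extend (\<lambda>k. f k - g k) p = frag_extend f p - frag_extend g p"
proof -
  have "Poly_Mapping.keys p \<subseteq> UNIV" by simp
  then show ?thesis
    by (induction p rule: frag_induction) (simp_all add: frag_extend_diff)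
qed

lemma frag_extend_tensor3_null:
  assumes "\<And>k. f k \<in> tensor3_null scale"
  shows "frag_extend f p \<in> tensor3_null scale"
proof -
  have "Poly_Mapping.keys p \<subseteq> UNIV" by simp
  then show ?thesis
    by (induction p rule: frag_induction)
      (simp_all add: frag_extend_diff assms tensor3_null.intros)
qed

context dialgebra
begin

lemma product_simps:
  "(x + y) \<rhd> z = x \<rhd> z + y \<rhd> z" "z \<rhd> (x + y) = z \<rhd> x + z \<rhd> y"
  "scale c x \<rhd> y = scale c (x \<rhd> y)" "x \<rhd> scale c y = scale c (x \<rhd> y)"
  "(x + y) \<lhd> z = x \<lhd> z + y \<lhd> z" "z \<lhd> (x + y) = z \<lhd> x + z \<lhd> y"
  "scale c x \<lhd> y = scale c (x \<lhd> y)" "x \<lhd> scale c y = scale c (x \<lhd> y)"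
proof -
  have 1: "Vector_Spaces.linear scale scale (\<lambda>y. x \<rhd> y)"
    "Vector_Spaces.linear scale scale (\<lambda>x. x \<rhd> y)"
    "Vector_Spaces.linear scale scale (\<lambda>y. x \<lhd> y)"
    "Vector_Spaces.linear scale scale (\<lambda>x. x \<lhd> y)" for x y
    using bilinear_dr bilinear_dl by (simp_all add: bilinear_map_def)
  note add = module_hom.add[OF Vector_Spaces.linear.axioms(3)] and scl = module_hom.scale[OF Vector_Spaces.linear.axioms(3)]
  show "(x + y) \<rhd> z = x \<rhd> z + y \<rhd> z" by (rule add[OF 1(2)])
  show "z \<rhd> (x + y) = z \<rhd> x + z \<rhd> y" by (rule add[OF 1(1)])
  show "(x + y) \<lhd> z = x \<lhd> z + y \<lhd> z" by (rule add[OF 1(4)])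
  show "z \<lhd> (x + y) = z \<lhd> x + z \<lhd> y" by (rule add[OF 1(3)])
  show "scale c x \<rhd> y = scale c (x \<rhd> y)" by (rule scl[OF 1(2)])
  show "x \<rhd> scale c y = scale c (x \<rhd> y)" by (rule scl[OF 1(1)])
  show "scale c x \<lhd> y = scale c (x \<lhd> y)" by (rule scl[OF 1(4)])
  show "x \<lhd> scale c y = scale c (x \<lhd> y)" by (rule scl[OF 1(3)])
qed

lemma star_simps:
  "star (\<rhd>) (\<lhd>) (x + y) z = star (\<rhd>) (\<lhd>) x z + star (\<rhd>) (\<lhd>) y z"
  "star (\<rhd>) (\<lhd>) z (x + y) = star (\<rhd>) (\<lhd>) z x + star (\<rhd>) (\<lhd>) z y"
  "star (\<rhd>) (\<lhd>) (scale c x) y = scale c (star (\<rhd>) (\<lhd>) x y)"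
  "star (\<rhd>) (\<lhd>) x (scale c y) = scale c (star (\<rhd>) (\<lhd>) x y)"
  by (simp_all add: star_def product_simps scale_right_diff_distrib)

lemma E_F_null:
  assumes "p \<in> tensor2_null scale"
  shows "E_op (\<rhd>) (\<lhd>) x p \<in> tensor2_null scale" "F_op (\<rhd>) (\<lhd>) x p \<in> tensor2_null scale"
proof -
  have lin: "Vector_Spaces.linear scale scale f"
    if "\<And>x y. f (x + y) = f x + f y" "\<And>c x. f (scale c x) = scale c (f x)" for f
    using that by unfold_locales
  have [simp]: "Vector_Spaces.linear scale scale id"
    "Vector_Spaces.linear scale scale ((\<lhd>) x)"
    "Vector_Spaces.linear scale scale (\<lambda>y. y \<rhd> x)"
    "Vector_Spaces.linear scale scale (star (\<rhd>) (\<lhd>) x)"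
    "Vector_Spaces.linear scale scale (\<lambda>y. star (\<rhd>) (\<lhd>) y x)" for x
    by (rule lin; simp add: product_simps star_simps)+
  show "E_op (\<rhd>) (\<lhd>) x p \<in> tensor2_null scale" "F_op (\<rhd>) (\<lhd>) x p \<in> tensor2_null scale"
    by (auto simp: E_op_def F_op_def intro!: tensor2_null_plus tensor2_null.diff tensor_map_null assms)
qed

abbreviation DAYBE_pure where
  "DAYBE_pure a b a' b' \<equiv>
    frag_of (a, a', b \<rhd> b') - frag_of (a', a \<lhd> b', b) - frag_of (star (\<rhd>) (\<lhd>) a a', b, b')"

lemma null3_lin:
  assumes "p = q1 - q2 - q3" "q1 \<in> tensor3_null scale" "q2 \<in> tensor3_null scale" "q3 \<in> tensor3_null scale"
  shows "p \<in> tensor3_null scale"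
  using assms by (auto intro: tensor3_null.diff)

lemma tensor3_scale13: "frag_of (scale c x, y, z) - frag_of (x, y, scale c z) \<in> tensor3_null scale"
  using tensor3_null_plus[OF tensor3_null.scale12[of scale c x y z] tensor3_null.scale23[of x scale c y z]]
  by simp

lemma DAYBE_pure_null:
  "DAYBE_pure (x + x') y a b - DAYBE_pure x y a b - DAYBE_pure x' y a b \<in> tensor3_null scale"
  "DAYBE_pure x (y + y') a b - DAYBE_pure x y a b - DAYBE_pure x y' a b \<in> tensor3_null scale"
  "DAYBE_pure (scale c x) y a b - DAYBE_pure x (scale c y) a b \<in> tensor3_null scale"
  "DAYBE_pure a b (x + x') y - DAYBE_pure a b x y - DAYBE_pure a b x' y \<in> tensor3_null scale"
  "DAYBE_pure a b x (y + y') - DAYBE_pure a b x y - DAYBE_pure a b x y' \<in> tensor3_null scale"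
  "DAYBE_pure a b (scale c x) y - DAYBE_pure a b x (scale c y) \<in> tensor3_null scale"
proof -
  have i: "frag_of (x + x', y, z) - frag_of (x, y, z) - frag_of (x', y, z) \<in> tensor3_null scale"
    "frag_of (x, y + y', z) - frag_of (x, y, z) - frag_of (x, y', z) \<in> tensor3_null scale"
    "frag_of (x, y, z + z') - frag_of (x, y, z) - frag_of (x, y, z') \<in> tensor3_null scale"
    "frag_of (scale c x, y, z) - frag_of (x, scale c y, z) \<in> tensor3_null scale"
    "frag_of (x, scale c y, z) - frag_of (x, y, scale c z) \<in> tensor3_null scale"
    "frag_of (scale c x, y, z) - frag_of (x, y, scale c z) \<in> tensor3_null scale"
    for x x' y y' z z' c
    by (rule tensor3_null.intros tensor3_scale13)+
  show "DAYBE_pure (x + x') y a b - DAYBE_pure x y a b - DAYBE_pure x' y a b \<in> tensor3_null scale"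
    by (rule null3_lin[OF _ i(1)[of x x' a "y \<rhd> b"] i(2)[of a "x \<lhd> b" "x' \<lhd> b" y]
          i(1)[of "star (\<rhd>) (\<lhd>) x a" "star (\<rhd>) (\<lhd>) x' a" y b]])
      (simp add: product_simps star_simps)
  show "DAYBE_pure x (y + y') a b - DAYBE_pure x y a b - DAYBE_pure x y' a b \<in> tensor3_null scale"
    by (rule null3_lin[OF _ i(3)[of x a "y \<rhd> b" "y' \<rhd> b"] i(3)[of a "x \<lhd> b" y y']
          i(2)[of "star (\<rhd>) (\<lhd>) x a" y y' b]])
      (simp add: product_simps star_simps)
  show "DAYBE_pure (scale c x) y a b - DAYBE_pure x (scale c y) a b \<in> tensor3_null scale"
    by (rule null3_lin[OF _ i(6)[of c x a "y \<rhd> b"] i(5)[of a c "x \<lhd> b" y]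
          i(4)[of c "star (\<rhd>) (\<lhd>) x a" y b]])
      (simp add: product_simps star_simps)
  show "DAYBE_pure a b (x + x') y - DAYBE_pure a b x y - DAYBE_pure a b x' y \<in> tensor3_null scale"
    by (rule null3_lin[OF _ i(2)[of a x x' "b \<rhd> y"] i(1)[of x x' "a \<lhd> y" b]
          i(1)[of "star (\<rhd>) (\<lhd>) a x" "star (\<rhd>) (\<lhd>) a x'" b y]])
      (simp add: product_simps star_simps)
  show "DAYBE_pure a b x (y + y') - DAYBE_pure a b x y - DAYBE_pure a b x y' \<in> tensor3_null scale"
    by (rule null3_lin[OF _ i(3)[of a x "b \<rhd> y" "b \<rhd> y'"] i(2)[of x "a \<lhd> y" "a \<lhd> y'" b]
          i(3)[of "star (\<rhd>) (\<lhd>) a x" b y y']])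
      (simp add: product_simps star_simps)
  show "DAYBE_pure a b (scale c x) y - DAYBE_pure a b x (scale c y) \<in> tensor3_null scale"
    by (rule null3_lin[OF _ i(5)[of a c x "b \<rhd> y"] i(4)[of c x "a \<lhd> y" b]
          i(6)[of c "star (\<rhd>) (\<lhd>) a x" b y]])
      (simp add: product_simps star_simps)
qed

lemma DAYBE_form_null1:
  assumes "p \<in> tensor2_null scale"
  shows "DAYBE_form (\<rhd>) (\<lhd>) p s \<in> tensor3_null scale"
  using assms
proof induction
  case zero
  show ?case by (simp add: DAYBE_form_def tensor3_null.zero)
next
  case (diff p q)
  then show ?case by (simp add: DAYBE_form_def frag_extend_diff tensor3_null.diff)
qed (auto simp: DAYBE_form_def frag_extend_diff simp flip: frag_extend_fun_diff
      intro!: frag_extend_tensor3_null DAYBE_pure_null)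

lemma DAYBE_form_null2:
  assumes "p \<in> tensor2_null scale"
  shows "DAYBE_form (\<rhd>) (\<lhd>) s p \<in> tensor3_null scale"
proof -
  have "frag_extend (\<lambda>(a', b'). DAYBE_pure a b a' b') p \<in> tensor3_null scale" for a b
    using assms
  proof induction
    case zero
    show ?case by (simp add: tensor3_null.zero)
  next
    case (diff p q)
    then show ?case by (simp add: frag_extend_diff tensor3_null.diff)
  qed (simp_all add: frag_extend_diff DAYBE_pure_null)
  then show ?thesis
    unfolding DAYBE_form_def by (intro frag_extend_tensor3_null) (simp only: split_paired_all split)
qed

lemma DAYBE_form_diff_left:
  "DAYBE_form (\<rhd>) (\<lhd>) (p - q) s = DAYBE_form (\<rhd>) (\<lhd>) p s - DAYBE_form (\<rhd>) (\<lhd>) q s"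
  by (simp add: DAYBE_form_def frag_extend_diff)

lemma DAYBE_form_diff_right:
  "DAYBE_form (\<rhd>) (\<lhd>) s (p - q) = DAYBE_form (\<rhd>) (\<lhd>) s p - DAYBE_form (\<rhd>) (\<lhd>) s q"
proof -
  have "frag_extend (\<lambda>k. frag_extend (G k) (p - q)) s =
      frag_extend (\<lambda>k. frag_extend (G k) p) s - frag_extend (\<lambda>k. frag_extend (G k) q) s"
    for G :: "'a \<times> 'a \<Rightarrow> 'a \<times> 'a \<Rightarrow> ('a \<times> 'a \<times> 'a \<Rightarrow>\<^sub>0 int)"
    by (simp only: frag_extend_diff frag_extend_fun_diff)
  from this[of "\<lambda>(a, b) (a', b'). DAYBE_pure a b a' b'"] show ?thesis
    by (simp only: DAYBE_form_def split_def)
qed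

lemma solves_DAYBE_cong:
  assumes "r - r' \<in> tensor2_null scale"
  shows "solves_DAYBE scale (\<rhd>) (\<lhd>) r \<longleftrightarrow> solves_DAYBE scale (\<rhd>) (\<lhd>) r'"
proof -
  have "DAYBE_form (\<rhd>) (\<lhd>) r r - DAYBE_form (\<rhd>) (\<lhd>) r' r' =
      DAYBE_form (\<rhd>) (\<lhd>) (r - r') r + DAYBE_form (\<rhd>) (\<lhd>) r' (r - r')"
    by (simp add: DAYBE_form_diff_left DAYBE_form_diff_right)
  then have *: "DAYBE_form (\<rhd>) (\<lhd>) r r - DAYBE_form (\<rhd>) (\<lhd>) r' r' \<in> tensor3_null scale"
    using tensor3_null_plus[OF DAYBE_form_null1[OF assms] DAYBE_form_null2[OF assms]] by simp
  show ?thesis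
    unfolding solves_DAYBE_def
    using tensor3_null_plus[OF _ *, of "DAYBE_form (\<rhd>) (\<lhd>) r' r'"]
      tensor3_null.diff[OF _ *, of "DAYBE_form (\<rhd>) (\<lhd>) r r"] by auto
qed

end

end

theory Submission
  imports Defs
begin

text \<open>
  Write \<open>T\<close> and \<open>T\<^sup>t\<close> for the two maps induced by \<open>r\<close>, and \<open>\<beta>(x, y) = \<langle>\<alpha>\<^sup>-\<^sup>1(x), y\<rangle>\<close>. Invariance of
  the skew-symmetric part says exactly that the skew form \<open>\<beta>\<close> is invariant. Pairing the DAYBE with
  \<open>u \<otimes> v \<otimes> w\<close> gives
  \<open>w(T u \<rhd> T v) = v(T\<^sup>t w \<lhd> T u) + u(T\<^sup>t v \<star> T\<^sup>t w)\<close>.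
  For \<open>x = \<alpha>(u)\<close>, \<open>y = \<alpha>(v)\<close>, substituting \<open>T\<^sup>t = T - \<alpha>\<close> and using invariance of \<open>\<beta>\<close> turns this
  into the Rota-Baxter identity for \<open>\<rhd>\<close>; the same identity with the functionals cyclically permuted
  yields the one for \<open>\<lhd>\<close>.
\<close>

section \<open>Pairing triple tensors with functionals\<close>

definition tensor3_pairing ::
    "(('a \<times> 'a \<times> 'a) \<Rightarrow>\<^sub>0 int) \<Rightarrow> ('a \<Rightarrow> 'f::field) \<Rightarrow> ('a \<Rightarrow> 'f) \<Rightarrow> ('a \<Rightarrow> 'f) \<Rightarrow> 'f"
  where "tensor3_pairing t u v w =
    (\<Sum>k \<in> Poly_Mapping.keys t. of_int (Poly_Mapping.lookup t k) *
      (u (fst k) * v (fst (snd k)) * w (snd (snd k))))"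

lemma tensor3_pairing_frag_of [simp]: "tensor3_pairing (frag_of (a, b, c)) u v w = u a * v b * w c"
  by (simp add: tensor3_pairing_def)

lemma tensor3_pairing_zero [simp]: "tensor3_pairing 0 u v w = 0"
  by (simp add: tensor3_pairing_def)

lemma tensor3_pairing_plus:
  "tensor3_pairing (p + q) u v w = tensor3_pairing p u v w + tensor3_pairing q u v w"
  using sum_keys_plus[of "\<lambda>k n. of_int n * (u (fst k) * v (fst (snd k)) * w (snd (snd k)))" p q]
  by (simp add: tensor3_pairing_def algebra_simps)

lemma tensor3_pairing_diff:
  "tensor3_pairing (p - q) u v w = tensor3_pairing p u v w - tensor3_pairing q u v w"
  using tensor3_pairing_plus[of "p - q" q u v w] by simp

text \<open>Turns membership in the null subgroup, the form in which the DAYBE is given, into a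
  scalar equation.\<close>

lemma tensor3_pairing_null:
  assumes "p \<in> tensor3_null scale"
    and "u \<in> dual_space scale" "v \<in> dual_space scale" "w \<in> dual_space scale"
  shows "tensor3_pairing p u v w = 0"
  using assms(1)
  by induction (simp_all add: tensor3_pairing_diff tensor3_pairing_plus dual_space_simps[OF assms(2)]
      dual_space_simps[OF assms(3)] dual_space_simps[OF assms(4)] algebra_simps)

lemma tensor_pairing_map:
  "tensor_pairing (tensor_map f g p) u v = tensor_pairing p (\<lambda>x. u (f x)) (\<lambda>x. v (g x))"
proof -
  have "Poly_Mapping.keys p \<subseteq> UNIV" by simp
  then show ?thesis
  proof (induction p rule: frag_induction)
    case zero
    show ?case by (simp add: tensor_map_def tensor_pairing_def)
  next
    case (one k)
    show ?case by (cases k) (simp add: tensor_map_def)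
  next
    case (diff p q)
    then show ?case by (simp add: tensor_map_def frag_extend_diff tensor_pairing_diff)
  qed
qed

context vector_space
begin

lemma tensor_hom_diff: "tensor_hom scale (p - q) u = tensor_hom scale p u - tensor_hom scale q u"
  by (rule dual_space_separates[OF vector_space_axioms])
    (simp add: dual_space_simps tensor_hom_dual tensor_pairing_diff)

lemma tensor_hom_t_diff:
  "tensor_hom_t scale (p - q) u = tensor_hom_t scale p u - tensor_hom_t scale q u"
  by (rule dual_space_separates[OF vector_space_axioms])
    (simp add: dual_space_simps tensor_hom_t_dual tensor_pairing_diff)

lemma tensor_hom_zero [simp]: "tensor_hom scale 0 u = 0" "tensor_hom_t scale 0 u = 0"
  by (simp_all add: tensor_hom_def tensor_hom_t_def)

lemma tensor_hom_frag_of [simp]: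
  "tensor_hom scale (frag_of (a, b)) u = scale (u a) b"
  "tensor_hom_t scale (frag_of (a, b)) u = scale (u b) a"
  by (simp_all add: tensor_hom_def tensor_hom_t_def)

lemma linearI:
  assumes "\<And>x y. f (x + y) = f x + f y" "\<And>c x. f (scale c x) = scale c (f x)"
  shows "Vector_Spaces.linear scale scale f"
  using assms by unfold_locales

lemma dual_spaceI:
  assumes "\<And>x y. u (x + y) = u x + u y" "\<And>c x. u (scale c x) = c * u x"
  shows "u \<in> dual_space scale"
  unfolding dual_space_def
  by (simp, unfold_locales) (simp_all add: assms algebra_simps)

end

section \<open>Contracting the DAYBE with three functionals\<close>

context dialgebra
begin

abbreviation sstar (infixl \<open>\<star>\<close> 70) where "x \<star> y \<equiv> star (\<rhd>) (\<lhd>) x y"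

lemma product_zero [simp]:
  "0 \<rhd> x = 0" "x \<rhd> 0 = 0" "0 \<lhd> x = 0" "x \<lhd> 0 = 0" "0 \<star> x = 0" "x \<star> 0 = 0"
  using product_simps(3)[of 0 0 x] product_simps(4)[of x 0 0] product_simps(7)[of 0 0 x]
    product_simps(8)[of x 0 0]
  by (simp_all add: star_def)

lemma product_diff:
  "(x - y) \<rhd> z = x \<rhd> z - y \<rhd> z" "z \<rhd> (x - y) = z \<rhd> x - z \<rhd> y"
  "(x - y) \<lhd> z = x \<lhd> z - y \<lhd> z" "z \<lhd> (x - y) = z \<lhd> x - z \<lhd> y"
  using product_simps(1)[of "x - y" y z] product_simps(2)[of z "x - y" y]
    product_simps(5)[of "x - y" y z] product_simps(6)[of z "x - y" y]
  by (simp_all add: algebra_simps)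

lemma star_diff: "(x - y) \<star> z = x \<star> z - y \<star> z" "z \<star> (x - y) = z \<star> x - z \<star> y"
  by (simp_all add: star_def product_diff)

lemma dual_space_products:
  assumes "u \<in> dual_space scale"
  shows "(\<lambda>y. u (y \<rhd> x)) \<in> dual_space scale" "(\<lambda>y. u (x \<lhd> y)) \<in> dual_space scale"
    "(\<lambda>y. u (y \<star> x)) \<in> dual_space scale" "(\<lambda>y. u (x \<star> y)) \<in> dual_space scale"
  by (rule dual_spaceI; simp add: product_simps star_simps dual_space_simps[OF assms])+

text \<open>Both sides are biadditive in \<open>p\<close> and \<open>q\<close>, so pure tensors
  suffice. Two independent tensors are kept because the case \<open>p = q\<close> is quadratic and
  would not allow induction.\<close>

lemma DAYBE_form_pairing:
  assumes u: "u \<in> dual_space scale" and v: "v \<in> dual_space scale" and w: "w \<in> dual_space scale"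
  shows "tensor3_pairing (DAYBE_form (\<rhd>) (\<lhd>) p q) u v w =
    w (tensor_hom scale p u \<rhd> tensor_hom scale q v)
    - v (tensor_hom_t scale p w \<lhd> tensor_hom scale q u)
    - u (tensor_hom_t scale p v \<star> tensor_hom_t scale q w)"
proof -
  note simps = dual_space_simps[OF u] dual_space_simps[OF v] dual_space_simps[OF w]
    product_simps star_simps product_diff star_diff tensor_hom_diff tensor_hom_t_diff
  have "Poly_Mapping.keys p \<subseteq> UNIV" by simp
  then show ?thesis
  proof (induction p rule: frag_induction)
    case zero
    show ?case by (simp add: DAYBE_form_def simps)
  next
    case (one k)
    obtain a b where k: "k = (a, b)" by (cases k)
    have "Poly_Mapping.keys q \<subseteq> UNIV" by simp
    then show ?case
    proof (induction q rule: frag_induction)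
      case zero
      show ?case by (simp add: DAYBE_form_def simps k)
    next
      case (one k')
      show ?case by (cases k') (simp add: DAYBE_form_def simps k tensor3_pairing_diff)
    next
      case (diff p' q')
      then show ?case by (simp add: DAYBE_form_diff_right tensor3_pairing_diff simps)
    qed
  next
    case (diff p' q')
    then show ?case by (simp add: DAYBE_form_diff_left tensor3_pairing_diff simps)
  qed
qed

end

section \<open>The skew form \<open>\<phi> x y\<close> and its invariance\<close>

context factorizable_bidialgebra
begin

abbreviation "T \<equiv> tensor_hom scale r"
abbreviation "Tt \<equiv> tensor_hom_t scale r"
abbreviation "\<alpha> \<equiv> alpha_hom scale r"
abbreviation "\<phi> \<equiv> alpha_inv scale r"

lemma alpha_inv_dual: "\<phi> x \<in> dual_space scale"
  using factorizable unfolding alpha_inv_def bij_betw_def by (metis UNIV_I inv_into_into)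

lemma alpha_alpha_inv: "\<alpha> (\<phi> x) = x"
  using factorizable unfolding alpha_inv_def by (simp add: bij_betw_inv_into_right)

lemma alpha_inv_alpha: "u \<in> dual_space scale \<Longrightarrow> \<phi> (\<alpha> u) = u"
  using factorizable unfolding alpha_inv_def by (simp add: bij_betw_inv_into_left)

lemmas alpha_inv_simps = dual_space_simps[OF alpha_inv_dual]

lemma tensor_hom_adjoint:
  assumes "u \<in> dual_space scale" "v \<in> dual_space scale"
  shows "v (T u) = u (Tt v)"
  using assms by (simp add: tensor_hom_dual tensor_hom_t_dual)

lemma tensor_hom_alpha_inv: "T (\<phi> x) = Tt (\<phi> x) + x"
  using alpha_alpha_inv[of x] by (simp add: alpha_hom_def algebra_simps)

text \<open>\<open>T\<close> and \<open>Tt\<close> are adjoint, so their difference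
  \<open>\<alpha>\<close> is minus its own adjoint.\<close>

lemma alpha_inv_skew: "\<phi> x y = - \<phi> y x"
proof -
  have "\<phi> x (\<alpha> (\<phi> y)) = - \<phi> y (\<alpha> (\<phi> x))"
    using tensor_hom_adjoint[OF alpha_inv_dual alpha_inv_dual]
    by (simp add: alpha_hom_def alpha_inv_simps)
  then show ?thesis by (simp add: alpha_alpha_inv)
qed

text \<open>Skew-symmetry exchanges the arguments, which reduces linearity of the inverse to
  linearity of the functional \<open>\<phi> z\<close>.\<close>

lemma alpha_inv_linear:
  "\<phi> (x + y) z = \<phi> x z + \<phi> y z" "\<phi> (x - y) z = \<phi> x z - \<phi> y z"
  "\<phi> (- x) z = - \<phi> x z" "\<phi> (scale c x) z = c * \<phi> x z"
  by (simp_all add: alpha_inv_skew[of _ z] alpha_inv_simps)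

text \<open>Pairing \<open>E(x) s = 0\<close> and \<open>F(x) s = 0\<close> with
  \<open>u \<otimes> v\<close> transposes the operator of the first slot onto \<open>u\<close> and
  applies that of the second slot to \<open>\<alpha> u\<close>; the functional \<open>v\<close> is
  arbitrary.\<close>

lemma alpha_equivariant:
  assumes u: "u \<in> dual_space scale"
  shows "\<alpha> (\<lambda>y. u (y \<star> x)) = - (x \<lhd> \<alpha> u)" "\<alpha> (\<lambda>y. u (y \<rhd> x)) = x \<star> \<alpha> u"
proof -
  let ?s = "r - tensor_flip r"
  note E = tensor_pairing_null[of "E_op (\<rhd>) (\<lhd>) x ?s" scale]
    and F = tensor_pairing_null[of "F_op (\<rhd>) (\<lhd>) x ?s" scale]
  have inv: "E_op (\<rhd>) (\<lhd>) x ?s \<in> tensor2_null scale" "F_op (\<rhd>) (\<lhd>) x ?s \<in> tensor2_null scale"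
    using invariant_skew_part by (auto simp: invariant_tensor_def)
  have pair: "tensor_pairing ?s u' v = v (\<alpha> u')"
    if "u' \<in> dual_space scale" "v \<in> dual_space scale" for u' v
    using that by (simp add: alpha_hom_eq[OF vector_space_axioms] tensor_hom_dual)
  note simps = E_op_def F_op_def tensor_pairing_plus tensor_pairing_diff[of "tensor_map _ _ _"]
    tensor_pairing_map pair dual_space_products dual_space_simps
  show "\<alpha> (\<lambda>y. u (y \<star> x)) = - (x \<lhd> \<alpha> u)"
  proof (rule dual_space_separates[OF vector_space_axioms])
    fix v assume "v \<in> dual_space scale"
    with E[OF inv(1) u this] u show "v (\<alpha> (\<lambda>y. u (y \<star> x))) = v (- (x \<lhd> \<alpha> u))"
      by (simp add: simps eq_neg_iff_add_eq_0)
  qed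
  show "\<alpha> (\<lambda>y. u (y \<rhd> x)) = x \<star> \<alpha> u"
  proof (rule dual_space_separates[OF vector_space_axioms])
    fix v assume "v \<in> dual_space scale"
    with F[OF inv(2) u this] u show "v (\<alpha> (\<lambda>y. u (y \<rhd> x))) = v (x \<star> \<alpha> u)"
      by (simp add: simps)
  qed
qed

text \<open>Apply \<open>\<phi>\<close> to the equivariance of \<open>\<alpha>\<close> at
  \<open>u = \<phi> y\<close>, where \<open>\<alpha> u = y\<close>.\<close>

lemma alpha_inv_dl_left: "\<phi> (x \<lhd> y) z = - \<phi> y (z \<star> x)"
proof -
  have "\<phi> y (z \<star> x) = \<phi> (- (x \<lhd> y)) z"
    using alpha_inv_alpha[OF dual_space_products(3)[OF alpha_inv_dual[of y]]]
      alpha_equivariant(1)[OF alpha_inv_dual[of y]]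
    by (metis alpha_alpha_inv)
  then show ?thesis
    by (simp add: alpha_inv_skew[of _ z] alpha_inv_simps)
qed

lemma alpha_inv_star: "\<phi> (x \<star> y) z = \<phi> y (z \<rhd> x)"
  using alpha_inv_alpha[OF dual_space_products(1)[OF alpha_inv_dual[of y]]]
    alpha_equivariant(2)[OF alpha_inv_dual[of y]]
  by (metis alpha_alpha_inv)

text \<open>This and \<open>alpha_inv_dr\<close> are the two invariance axioms of a Frobenius
  form.\<close>

lemma alpha_inv_dl: "\<phi> (x \<lhd> y) z = \<phi> x (y \<rhd> z)"
  using alpha_inv_dl_left[of x y z] alpha_inv_star[of z x y] alpha_inv_skew[of y] by simp

lemma alpha_inv_dr: "\<phi> (x \<rhd> y) z = \<phi> x (y \<star> z)"
  using alpha_inv_star[of y z x] alpha_inv_skew[of x] alpha_inv_skew[of z] by simp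

lemma alpha_inv_dr_left: "\<phi> (x \<rhd> y) z = \<phi> y (z \<lhd> x)"
  using alpha_inv_dl[of z x y] alpha_inv_skew[of y] alpha_inv_skew[of z] by simp

section \<open>From the DAYBE to the Rota-Baxter identities\<close>

lemma DAYBE_pairing:
  assumes "u \<in> dual_space scale" "v \<in> dual_space scale" "w \<in> dual_space scale"
  shows "w (T u \<rhd> T v) = v (Tt w \<lhd> T u) + u (Tt v \<star> Tt w)"
  using DAYBE_form_pairing[OF assms, of r r] tensor3_pairing_null[OF _ assms] DAYBE
  by (simp add: solves_DAYBE_def algebra_simps)

text \<open>By adjointness the right side is \<open>\<phi> z (T (\<phi> s))\<close> with
  \<open>s\<close> the bracketed sum, so this is the Rota-Baxter identity of weight -1 for
  \<open>T \<circ> \<phi>\<close>, tested against \<open>\<phi> z\<close>.\<close>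

lemma tensor_hom_dr:
  "\<phi> z (T (\<phi> x) \<rhd> T (\<phi> y)) =
    \<phi> (T (\<phi> x) \<rhd> y + x \<rhd> T (\<phi> y) - x \<rhd> y) (Tt (\<phi> z))"
proof -
  \<comment> \<open>Both sides are \<open>\<phi> (x \<rhd> y) (Tt (\<phi> z))\<close>, a term that
    matches both invariance rules used below.\<close>
  have "\<phi> x (y \<star> Tt (\<phi> z)) = \<phi> y (Tt (\<phi> z) \<lhd> x)"
    by (simp flip: alpha_inv_dr alpha_inv_dr_left)
  with DAYBE_pairing[OF alpha_inv_dual[of x] alpha_inv_dual[of y] alpha_inv_dual[of z]]
  show ?thesis
    by (simp add: alpha_inv_linear alpha_inv_dr[of x] alpha_inv_dr_left[of _ y]
        tensor_hom_alpha_inv[of y] star_simps alpha_inv_simps)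
qed

lemma tensor_hom_dl:
  "\<phi> z (T (\<phi> x) \<lhd> T (\<phi> y)) =
    \<phi> (T (\<phi> x) \<lhd> y + x \<lhd> T (\<phi> y) - x \<lhd> y) (Tt (\<phi> z))"
proof -
  define p q c where defs: "p = T (\<phi> x)" "q = T (\<phi> y)" "c = Tt (\<phi> z)"
  \<comment> \<open>The cyclic choice \<open>u = \<phi> y\<close>, \<open>v = \<phi> z\<close>,
    \<open>w = \<phi> x\<close> makes \<open>\<phi> z\<close> evaluate a \<open>\<lhd>\<close>
    product.\<close>
  have "\<phi> x (q \<rhd> (c + z)) = \<phi> z ((p - x) \<lhd> q) + \<phi> y (c \<star> (p - x))"
    using DAYBE_pairing[OF alpha_inv_dual[of y] alpha_inv_dual[of z] alpha_inv_dual[of x]]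
    by (simp add: defs tensor_hom_alpha_inv)
  \<comment> \<open>Cancels the \<open>z\<close> part on the left against the \<open>x\<close> part
    of \<open>\<phi> z ((p - x) \<lhd> q)\<close>.\<close>
  moreover have "\<phi> x (q \<rhd> z) = - \<phi> z (x \<lhd> q)"
    using alpha_inv_dl[of x q z] alpha_inv_skew[of z] by simp
  ultimately have "\<phi> z (p \<lhd> q) = \<phi> (p \<lhd> y + x \<lhd> q - x \<lhd> y) c"
    by (simp add: alpha_inv_linear alpha_inv_dl_left[of _ y] alpha_inv_dl[of x q]
        product_simps product_diff star_diff alpha_inv_simps)
  then show ?thesis by (simp add: defs)
qed

text \<open>Scaling an operator of weight -1 by \<open>- l\<close> gives one of weight
  \<open>l\<close>.\<close>

lemma Rota_Baxter_identity:
  fixes l :: 'f and m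
  defines "P \<equiv> \<lambda>x. scale (- l) (T (\<phi> x))"
  assumes m: "m = (\<rhd>) \<or> m = (\<lhd>)"
  shows "m (P x) (P y) = P (m (P x) y + m x (P y) + scale l (m x y))"
proof (rule dual_space_separates[OF vector_space_axioms])
  fix w assume w: "w \<in> dual_space scale"
  \<comment> \<open>Every functional \<open>w\<close> is \<open>\<phi> z\<close> for
    \<open>z = \<alpha> w\<close>, so the tested identities cover the whole dual.\<close>
  have "\<phi> (\<alpha> w) (m (T (\<phi> x)) (T (\<phi> y))) =
      \<phi> (m (T (\<phi> x)) y + m x (T (\<phi> y)) - m x y) (Tt (\<phi> (\<alpha> w)))"
    using m tensor_hom_dr tensor_hom_dl by blast
  then have key: "w (m (T (\<phi> x)) (T (\<phi> y))) =
      \<phi> (m (T (\<phi> x)) y) (Tt w) + \<phi> (m x (T (\<phi> y))) (Tt w) - \<phi> (m x y) (Tt w)"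
    by (simp add: alpha_inv_alpha[OF w] alpha_inv_linear)
  have mP: "m (P x') y' = scale (- l) (m (T (\<phi> x')) y')"
    "m x' (P y') = scale (- l) (m x' (T (\<phi> y')))" for x' y'
    using m unfolding P_def by (elim disjE; simp only: product_simps)+
  have wP: "w (P s) = - l * \<phi> s (Tt w)" for s
    by (simp add: P_def dual_space_simps[OF w] tensor_hom_adjoint[OF alpha_inv_dual w])
  show "w (m (P x) (P y)) = w (P (m (P x) y + m x (P y) + scale l (m x y)))"
    unfolding wP unfolding mP
    by (simp add: dual_space_simps[OF w] alpha_inv_linear key algebra_simps)
qed

end

theorem theorem4p25:
  fixes scale :: "'f::field_char_0 \<Rightarrow> 'a::ab_group_add \<Rightarrow> 'a"
    and dr dl :: "'a \<Rightarrow> 'a \<Rightarrow> 'a"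
    and r :: "('a \<times> 'a) \<Rightarrow>\<^sub>0 int"
    and l :: 'f
  assumes "factorizable_bidialgebra scale dr dl r"
    and "l \<noteq> 0"
  shows "skew_symmetric_Rota_Baxter_Frobenius_dialgebra scale dr dl
           (\<lambda>x y. - l * alpha_inv scale r x y)
           (\<lambda>x. scale (- l) (tensor_hom scale r (alpha_inv scale r x)))
           l"
proof -
  interpret factorizable_bidialgebra scale dr dl r by (rule assms(1))
  note skew = alpha_inv_skew
  \<comment> \<open>Each functional \<open>v\<close> is \<open>\<phi> (\<alpha> v)\<close>; by
    skew-symmetry all of them vanish at \<open>x\<close>.\<close>
  have zero: "x = 0" if "\<And>y. \<phi> x y = 0" for x
  proof (rule dual_space_separates[OF vector_space_axioms])
    fix v assume v: "v \<in> dual_space scale"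
    have "v x = - \<phi> x (\<alpha> v)" using skew[of "\<alpha> v" x] by (simp add: alpha_inv_alpha[OF v])
    then show "v x = v 0" using that by (simp add: dual_space_simps[OF v])
  qed
  have bilinear: "bilinear_map scale (*) (\<lambda>x y. - l * \<phi> x y)"
    unfolding bilinear_map_def
    by (intro conjI allI; rule dual_spaceI[unfolded dual_space_def mem_Collect_eq];
        simp add: alpha_inv_linear alpha_inv_simps algebra_simps)
  \<comment> \<open>Tested against \<open>v\<close>, adjointness turns \<open>T (\<phi> x)\<close>
    into \<open>\<phi> x (Tt v)\<close>.\<close>
  have linear: "Vector_Spaces.linear scale scale (\<lambda>x. scale (- l) (T (\<phi> x)))"
    by (rule linearI; rule dual_space_separates[OF vector_space_axioms])
      (simp_all add: dual_space_simps tensor_hom_adjoint alpha_inv_dual alpha_inv_linear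
        algebra_simps)
  \<comment> \<open>The first summand is \<open>- \<phi> x (Tt (\<phi> y))\<close>, and
    \<open>T (\<phi> y)\<close> exceeds \<open>Tt (\<phi> y)\<close> by \<open>y\<close>.\<close>
  have compatible: "\<phi> (T (\<phi> x)) y + \<phi> x (T (\<phi> y)) = \<phi> x y" for x y
    using skew[of "T (\<phi> x)" y] tensor_hom_adjoint[OF alpha_inv_dual[of x] alpha_inv_dual[of y]]
      tensor_hom_alpha_inv[of y]
    by (simp add: alpha_inv_simps)
  show ?thesis
  proof
    show "bilinear_map scale (*) (\<lambda>x y. - l * \<phi> x y)" by (rule bilinear)
    show "x = 0" if "\<And>y. - l * \<phi> x y = 0" for x
      using that assms(2) by (intro zero) simp
    show "y = 0" if "\<And>x. - l * \<phi> x y = 0" for y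
      using that assms(2) skew[of y] by (intro zero) simp
    show "- l * \<phi> x y = - (- l * \<phi> y x)" for x y
      using skew[of x y] by simp
    show "- l * \<phi> (dr x y) z = - l * \<phi> x (dr y z - dl y z)" for x y z
      by (simp add: alpha_inv_dr star_def)
    show "- l * \<phi> (dl x y) z = - l * \<phi> x (dr y z)" for x y z
      by (simp add: alpha_inv_dl)
    show "Rota_Baxter_operator scale dr dl l (\<lambda>x. scale (- l) (T (\<phi> x)))"
      unfolding Rota_Baxter_operator_def using linear Rota_Baxter_identity by blast
    show "- l * \<phi> (scale (- l) (T (\<phi> x))) y + - l * \<phi> x (scale (- l) (T (\<phi> y)))
        + l * (- l * \<phi> x y) = 0" for x y
      unfolding compatible[of x y, symmetric]
      by (simp add: alpha_inv_linear alpha_inv_simps algebra_simps)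
  qed
qed

end
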